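(* Let $\mathbb{F}$ be an infinite field and let $L$ be a finite set of lines in $\mathbb{F}^2$, each the graph $y=ax+b$ of an affine map with $a,b\in\mathbb{F}$, $a\neq 0$. For all $\epsilon>0$ and all $N>0$ there exists a finite subset $Y\subseteq\mathbb{F}$ such that $|Y|\geq N$ and $|(Y\times Y)\cap\ell|\geq(1-\epsilon)|Y|$ for all $\ell\in L$. *)

theory Defs
  imports Complex_Main
begin

definition graph_line :: "'a::field \<Rightarrow> 'a \<Rightarrow> ('a \<times> 'a) set" where
  "graph_line a b = {(x, y). y = a * x + b}"

end

(*
  Affine maps y -> a y + b form a solvable, hence amenable, group; the required Y is a Foelner set.
  Writing a^e for the product of the powers a_l^(e_l), take the words
      a^e (t + sum_(l,m) c_(l,m) b_l a^(-m)),   e and m in {0..<n}^L,  0 <= c_(l,m) < n.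
  Applying y -> a_l y + b_l raises e_l by one and then raises c_(l,e) by one, which leaves the index
  set only for a proportion at most 2/n of the words.  Different words may have the same value, so
  one obtains an almost invariant weight on the field rather than a set; by the layer cake formula
  some superlevel set of the weight is almost invariant.  As F is infinite, t can be chosen such that
  the values avoid any given finite set, and disjoint unions of almost invariant sets make the
  cardinality arbitrarily large.
*)

theory Submission
  imports Defs "HOL-Library.FuncSet"
begin

section \<open>From an almost invariant weight to an almost invariant set\<close>

text \<open>Weight each value by its number of indices. Summed over all levels, the sizes of the
  superlevel sets give \<open>card I\<close>, and the numbers of points that \<open>g k\<close>
  moves out of them are bounded by the indices that \<open>s k\<close> moves out of
  \<open>I\<close>. Averaging then gives one good level. The factor \<open>card K\<close> arises
  because that level must serve all \<open>k\<close> at once.\<close>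

lemma almost_invariant_superlevel_set:
  fixes \<phi> :: "'i \<Rightarrow> 'b" and g :: "'k \<Rightarrow> 'b \<Rightarrow> 'b" and s :: "'k \<Rightarrow> 'i \<Rightarrow> 'i" and \<delta> :: real
  assumes I: "finite I" "I \<noteq> {}"
    and inj: "\<And>k. k \<in> K \<Longrightarrow> inj_on (s k) I"
    and eqv: "\<And>k x. k \<in> K \<Longrightarrow> x \<in> I \<Longrightarrow> s k x \<in> I \<Longrightarrow> \<phi> (s k x) = g k (\<phi> x)"
    and bd: "\<And>k. k \<in> K \<Longrightarrow> real (card {x\<in>I. s k x \<notin> I}) \<le> \<delta> * real (card I)"
    and K: "finite K"
  obtains Y where "Y \<subseteq> \<phi> ` I" "Y \<noteq> {}"
    "\<And>k. k \<in> K \<Longrightarrow> real (card {y\<in>Y. g k y \<notin> Y}) \<le> real (card K) * \<delta> * real (card Y)"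
proof -
  define f where "f y = card {x\<in>I. \<phi> x = y}" for y
  define Y where "Y r = {y\<in>\<phi> ` I. r < f y}" for r
  define B where "B k r = {y\<in>Y r. g k y \<notin> Y r}" for k r
  have finY: "finite (Y r)" and finB: "finite (B k r)" for k r
    using I by (auto simp: Y_def B_def)
  have f_pos: "0 < f y \<longleftrightarrow> y \<in> \<phi> ` I" for y
    unfolding f_def using I by (auto simp: card_gt_0_iff)
  have f_le: "f y \<le> card I" for y
    unfolding f_def by (rule card_mono) (use I in auto)
  have fibres: "(\<Sum>y\<in>\<phi> ` I. card {x\<in>I. P x \<and> \<phi> x = y}) = card {x\<in>I. P x}" for P
  proof -
    have "(\<Sum>y\<in>\<phi> ` I. sum (\<lambda>_. 1::nat) {x \<in> {x\<in>I. P x}. \<phi> x = y})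
        = sum (\<lambda>_. 1) {x\<in>I. P x}"
      by (rule sum.group) (use I in auto)
    then show ?thesis by (simp add: conj_assoc)
  qed
  have sumY: "(\<Sum>r<card I. card (Y r)) = card I"
  proof -
    have "(\<Sum>r<card I. card (Y r)) = (\<Sum>y\<in>\<phi> ` I. card {r\<in>{..<card I}. r < f y})"
      using sum.swap_restrict[of "{..<card I}" "\<phi> ` I" "\<lambda>_ _. 1::nat" "\<lambda>r y. r < f y"] I
      by (simp add: Y_def)
    also have "\<dots> = (\<Sum>y\<in>\<phi> ` I. f y)"
    proof (rule sum.cong[OF refl])
      fix y
      have "{r\<in>{..<card I}. r < f y} = {..<f y}"
        using f_le[of y] by auto
      then show "card {r\<in>{..<card I}. r < f y} = f y" by simp
    qed
    also have "\<dots> = card I"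
      using fibres[of "\<lambda>_. True"] by (simp add: f_def)
    finally show ?thesis .
  qed
  have sumB: "(\<Sum>r<card I. card (B k r)) \<le> card {x\<in>I. s k x \<notin> I}" if k: "k \<in> K" for k
  proof -
    have B_eq: "B k r = {y\<in>\<phi> ` I. f (g k y) \<le> r \<and> r < f y}" for r
    proof -
      \<comment> \<open>This covers points outside the image too: there \<open>f z\<close> is 0, so
        they lie in no superlevel set. Hence \<open>g k y\<close> need not be a value of
        \<open>\<phi>\<close>.\<close>
      have "z \<in> Y r \<longleftrightarrow> r < f z" for z
        using f_pos[of z] by (auto simp: Y_def)
      then show ?thesis by (auto simp: B_def Y_def not_less)
    qed
    have "(\<Sum>r<card I. card (B k r))
        = (\<Sum>y\<in>\<phi> ` I. card {r\<in>{..<card I}. f (g k y) \<le> r \<and> r < f y})"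
      using sum.swap_restrict[of "{..<card I}" "\<phi> ` I" "\<lambda>_ _. 1::nat"
          "\<lambda>r y. f (g k y) \<le> r \<and> r < f y"] I
      by (simp add: B_eq)
    also have "\<dots> \<le> (\<Sum>y\<in>\<phi> ` I. card {x\<in>I. s k x \<notin> I \<and> \<phi> x = y})"
    proof (rule sum_mono)
      fix y
      \<comment> \<open>The point \<open>y\<close> is bad exactly at the levels between the weight
        of its image and its own weight. The truncated difference is right: if the weight does not
        drop, no level is bad.\<close>
      have "{r\<in>{..<card I}. f (g k y) \<le> r \<and> r < f y} = {f (g k y)..<f y}"
        using f_le[of y] by auto
      then have "card {r\<in>{..<card I}. f (g k y) \<le> r \<and> r < f y} = f y - f (g k y)"
        by simp
      moreover have "f y = card {x\<in>I. s k x \<notin> I \<and> \<phi> x = y} + card {x\<in>I. s k x \<in> I \<and> \<phi> x = y}"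
        unfolding f_def using I
        by (subst card_Un_disjoint[symmetric]) (auto intro!: arg_cong[where f = card])
      \<comment> \<open>Indices over \<open>y\<close> that stay in \<open>I\<close> are sent
        injectively into the fibre over \<open>g k y\<close>, so only the departing ones can make
        the weight drop.\<close>
      moreover have "card {x\<in>I. s k x \<in> I \<and> \<phi> x = y} \<le> f (g k y)"
        unfolding f_def
      proof (rule card_inj_on_le)
        show "inj_on (s k) {x\<in>I. s k x \<in> I \<and> \<phi> x = y}"
          using inj[OF k] by (rule inj_on_subset) auto
      qed (use I eqv[OF k] in auto)
      ultimately show "card {r\<in>{..<card I}. f (g k y) \<le> r \<and> r < f y}
          \<le> card {x\<in>I. s k x \<notin> I \<and> \<phi> x = y}"
        by linarith
    qed
    also have "\<dots> = card {x\<in>I. s k x \<notin> I}" by (rule fibres)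
    finally show ?thesis .
  qed
  have "\<exists>r. Y r \<noteq> {} \<and> (\<Sum>k\<in>K. real (card (B k r))) \<le> real (card K) * \<delta> * real (card (Y r))"
  proof (rule ccontr)
    assume "\<not> ?thesis"
    then have less: "real (card K) * \<delta> * real (card (Y r)) < (\<Sum>k\<in>K. real (card (B k r)))"
      if "Y r \<noteq> {}" for r
      using that by force
    have "(\<Sum>r<card I. real (card K) * \<delta> * real (card (Y r)))
        < (\<Sum>r<card I. \<Sum>k\<in>K. real (card (B k r)))"
    \<comment> \<open>Levels with \<open>Y r\<close> empty give only a weak inequality. Strictness
      comes from level 0, where \<open>Y 0\<close> is the whole image of \<open>I\<close>.\<close>
    proof (rule sum_strict_mono_ex1)
      show "\<forall>r\<in>{..<card I}. real (card K) * \<delta> * real (card (Y r)) \<le> (\<Sum>k\<in>K. real (card (B k r)))"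
      proof
        fix r show "real (card K) * \<delta> * real (card (Y r)) \<le> (\<Sum>k\<in>K. real (card (B k r)))"
          using less[of r] by (cases "Y r = {}") (auto intro: sum_nonneg)
      qed
      have "Y 0 \<noteq> {}" using I f_pos by (auto simp: Y_def)
      moreover have "0 < card I" using I by (simp add: card_gt_0_iff)
      ultimately show "\<exists>r\<in>{..<card I}.
          real (card K) * \<delta> * real (card (Y r)) < (\<Sum>k\<in>K. real (card (B k r)))"
        using less by blast
    qed simp
    also have "\<dots> = (\<Sum>k\<in>K. real (\<Sum>r<card I. card (B k r)))"
      by (subst sum.swap) simp
    also have "\<dots> \<le> (\<Sum>k\<in>K. \<delta> * real (card I))"
    proof (rule sum_mono)
      fix k assume k: "k \<in> K"
      have "real (\<Sum>r<card I. card (B k r)) \<le> real (card {x\<in>I. s k x \<notin> I})"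
        using sumB[OF k] by (simp only: of_nat_le_iff)
      then show "real (\<Sum>r<card I. card (B k r)) \<le> \<delta> * real (card I)"
        using bd[OF k] by linarith
    qed
    also have "\<dots> = real (card K) * \<delta> * real (\<Sum>r<card I. card (Y r))"
      by (simp only: sumY sum_constant mult.assoc)
    also have "\<dots> = (\<Sum>r<card I. real (card K) * \<delta> * real (card (Y r)))"
      by (simp add: sum_distrib_left)
    finally show False by simp
  qed
  then obtain r where r: "Y r \<noteq> {}"
    "(\<Sum>k\<in>K. real (card (B k r))) \<le> real (card K) * \<delta> * real (card (Y r))"
    by blast
  show thesis
  proof (rule that[of "Y r"])
    show "Y r \<subseteq> \<phi> ` I" by (auto simp: Y_def)
    show "Y r \<noteq> {}" by (rule r)
    fix k assume k: "k \<in> K"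
    have "real (card (B k r)) \<le> (\<Sum>k\<in>K. real (card (B k r)))"
      using k K by (intro member_le_sum) auto
    with r(2) show "real (card {y\<in>Y r. g k y \<notin> Y r}) \<le> real (card K) * \<delta> * real (card (Y r))"
      unfolding B_def by linarith
  qed
qed

section \<open>Words in the affine maps and their values\<close>

lemma card_PiE_slice:
  assumes "finite A" "i \<in> A" "v \<in> B" "finite B"
  shows "card {h \<in> A \<rightarrow>\<^sub>E B. h i = v} * card B = card (A \<rightarrow>\<^sub>E B)"
proof -
  have "{h \<in> A \<rightarrow>\<^sub>E B. h i = v} = PiE A (\<lambda>j. if j = i then {v} else B)"
    using assms by (auto simp: PiE_iff extensional_def split: if_splits)
  moreover have "card (PiE A (\<lambda>j. if j = i then {v} else B)) * card B = card (A \<rightarrow>\<^sub>E B)"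
    using assms by (simp add: card_PiE prod.remove[of A i] power_eq_if[of _ "card A"] card_eq_0_iff)
      blast
  ultimately show ?thesis by simp
qed

lemma almost_invariant_set_avoiding:
  fixes K :: "('a::field \<times> 'a) set" and \<epsilon> :: real
  assumes inf: "infinite (UNIV :: 'a set)" and K: "finite K"
    and nz: "\<And>k. k \<in> K \<Longrightarrow> fst k \<noteq> 0" and eps: "\<epsilon> > 0" and Z: "finite Z"
  obtains Y where "finite Y" "Y \<noteq> {}" "Y \<inter> Z = {}"
    "\<And>k. k \<in> K \<Longrightarrow> real (card {y\<in>Y. fst k * y + snd k \<notin> Y}) \<le> \<epsilon> * real (card Y)"
proof -
  \<comment> \<open>This makes \<open>card K * (2 / n)\<close> at most \<open>\<epsilon>\<close>: 2
    / n is the proportion of words leaving the index set, and \<open>card K\<close> is the loss in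
    passing to a level set.\<close>
  obtain n :: nat where n: "2 * real (card K) / \<epsilon> < real n"
    using reals_Archimedean2 by blast
  have "0 \<le> 2 * real (card K) / \<epsilon>" using eps by simp
  with n have n0: "n > 0" by linarith
  define E where "E = K \<rightarrow>\<^sub>E {..<n}"
  define A where "A = K \<times> E"
  define C where "C = A \<rightarrow>\<^sub>E {..<n}"
  define I where "I = E \<times> C"
  define w where "w e = (\<Prod>l\<in>K. fst l ^ e l)" for e :: "'a \<times> 'a \<Rightarrow> nat"
  define p where "p c = (\<Sum>x\<in>A. of_nat (c x) * (snd (fst x) / w (snd x)))"
    for c :: "('a \<times> 'a) \<times> ('a \<times> 'a \<Rightarrow> nat) \<Rightarrow> nat"
  define up where "up k e = e(k := Suc (e k))" for k and e :: "'a \<times> 'a \<Rightarrow> nat"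
  \<comment> \<open>The coefficient raised is the one at the new exponent \<open>up k e\<close>:
    writing w' for \<open>w (up k e)\<close>, adding \<open>snd k\<close> to w' * (t + p c) amounts
    to adding \<open>snd k\<close> / w' inside the bracket.\<close>
  define s where "s k = (\<lambda>(e, c). (up k e, c((k, up k e) := Suc (c (k, up k e)))))"
    for k :: "'a \<times> 'a" and c :: "('a \<times> 'a) \<times> ('a \<times> 'a \<Rightarrow> nat) \<Rightarrow> nat"
  have finE: "finite E" and finA: "finite A" and finC: "finite C" and finI: "finite I"
    using K by (auto simp: E_def A_def C_def I_def intro!: finite_PiE)
  have "E \<noteq> {}" "C \<noteq> {}" using n0 by (auto simp: E_def C_def PiE_eq_empty_iff)
  then have I_ne: "I \<noteq> {}" by (simp add: I_def)
  have w_nz: "w e \<noteq> 0" for e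
    using K nz by (auto simp: w_def)
  have w_up: "w (up k e) = fst k * w e" if "k \<in> K" for k e
    using that K unfolding w_def up_def
    by (simp add: prod.remove[of K k] mult.assoc)
  \<comment> \<open>These are the solutions t of \<open>w e * (t + p c) = z\<close>, one for each
    word and each forbidden value.\<close>
  define U where "U = (\<lambda>((e, c), z). z / w e - p c) ` (I \<times> Z)"
  have "finite U" using finI Z by (simp add: U_def)
  then obtain t where t: "t \<notin> U"
    using inf ex_new_if_finite by blast
  define \<phi> where "\<phi> = (\<lambda>(e, c). w e * (t + p c))"
  have inj: "inj (s k)" for k
  proof (rule injI)
    fix x y assume eq: "s k x = s k y"
    obtain e c e' c' where xy: "x = (e, c)" "y = (e', c')" by (cases x, cases y)
    from eq have up: "up k e = up k e'" by (simp add: s_def xy)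
    have "e j = e' j" for j
      using fun_cong[OF up, of j] by (cases "j = k") (simp_all add: up_def)
    then have e: "e = e'" by auto
    with eq have c: "c((k, up k e) := Suc (c (k, up k e))) = c'((k, up k e) := Suc (c' (k, up k e)))"
      by (simp add: s_def xy)
    have "c j = c' j" for j
      using fun_cong[OF c, of j] by (cases "j = (k, up k e)") simp_all
    then show "x = y" using e by (auto simp: xy)
  qed
  have eqv: "\<phi> (s k x) = fst k * \<phi> x + snd k"
    if k: "k \<in> K" and x: "s k x \<in> I" for k x
  proof -
    obtain e c where xe: "x = (e, c)" by (cases x)
    let ?e = "up k e" and ?c = "c((k, up k e) := Suc (c (k, up k e)))"
    \<comment> \<open>Here staying in \<open>I\<close> matters: it ensures that the raised
      coefficient belongs to a summand of \<open>p\<close>.\<close>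
    have "(k, ?e) \<in> A" using x k by (auto simp: xe s_def I_def A_def)
    then have "p ?c = snd k / w ?e + p c"
      unfolding p_def using finA
      by (simp add: sum.remove[of A "(k, ?e)"] add_divide_distrib distrib_right)
    then have "\<phi> (s k x) = w ?e * (t + p c) + snd k"
      using w_nz[of ?e] by (simp add: \<phi>_def s_def xe field_simps)
    then show ?thesis by (simp add: \<phi>_def xe w_up[OF k] mult.assoc)
  qed
  have bd: "real (card {x\<in>I. s k x \<notin> I}) \<le> 2 / real n * real (card I)" if k: "k \<in> K" for k
  proof -
    \<comment> \<open>A word leaves \<open>I\<close> either because the exponent of \<open>k\<close>
      is already maximal, or because the new exponent is admissible but the coefficient there is
      maximal. Each case accounts for at most 1/n of the words. In \<open>?Q\<close> the coefficient
      tested depends on \<open>e\<close>, so the count goes fibre by fibre.\<close>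
    let ?P = "{e\<in>E. e k = n - 1} \<times> C"
    let ?Q = "SIGMA e:{e\<in>E. up k e \<in> E}. {c\<in>C. c (k, up k e) = n - 1}"
    have "{x\<in>I. s k x \<notin> I} \<subseteq> ?P \<union> ?Q"
    proof (rule subsetI, rule UnCI)
      fix x assume x: "x \<in> {x\<in>I. s k x \<notin> I}" "x \<notin> ?Q"
      obtain e c where xe: "x = (e, c)" by (cases x)
      have ec: "(e, c) \<in> I" "s k (e, c) \<notin> I" "(e, c) \<notin> ?Q"
        using x by (simp_all add: xe)
      have e: "e \<in> E" and c: "c \<in> C" using ec by (auto simp: I_def)
      have "up k e \<notin> E"
      proof
        assume u: "up k e \<in> E"
        with ec e c have "c (k, up k e) \<noteq> n - 1" by auto
        moreover have kA: "(k, up k e) \<in> A" using u k by (simp add: A_def)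
        moreover have "c (k, up k e) < n" using c kA unfolding C_def by auto
        ultimately have "Suc (c (k, up k e)) < n" by linarith
        then have "c((k, up k e) := Suc (c (k, up k e))) \<in> C"
          using c kA unfolding C_def by (auto simp: PiE_iff extensional_def)
        then show False using ec(2) u by (simp add: s_def I_def)
      qed
      moreover have "up k e \<in> E" if "Suc (e k) < n"
        using e k that unfolding E_def up_def by (auto simp: PiE_iff extensional_def)
      moreover have "e k < n" using e k unfolding E_def by auto
      ultimately have "e k = n - 1" by linarith
      then show "x \<in> ?P" using e c by (simp add: xe)
    qed
    then have "card {x\<in>I. s k x \<notin> I} \<le> card ?P + card ?Q"
      using finE finC by (intro order_trans[OF card_mono card_Un_le]) auto
    then have "card {x\<in>I. s k x \<notin> I} * n \<le> card ?P * n + card ?Q * n"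
      by (simp only: add_mult_distrib[symmetric] mult_le_mono1)
    also have "card ?P * n = card I"
    proof -
      have "card {e\<in>E. e k = n - 1} * n = card E"
        using card_PiE_slice[of K k "n - 1" "{..<n}"] K k n0 by (simp add: E_def)
      moreover have "card ?P * n = card {e\<in>E. e k = n - 1} * n * card C"
        by (simp add: card_cartesian_product)
      ultimately show ?thesis by (simp only: I_def card_cartesian_product)
    qed
    also have "card ?Q * n \<le> card I"
    proof -
      have slice: "card {c\<in>C. c (k, up k e) = n - 1} * n = card C" if "up k e \<in> E" for e
        using card_PiE_slice[of A "(k, up k e)" "n - 1" "{..<n}"] finA k n0 that
        by (simp add: C_def A_def)
      have "card ?Q * n = (\<Sum>e\<in>{e\<in>E. up k e \<in> E}. card {c\<in>C. c (k, up k e) = n - 1} * n)"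
        using finE finC by (simp add: card_SigmaI sum_distrib_right)
      also have "\<dots> = (\<Sum>e\<in>{e\<in>E. up k e \<in> E}. card C)"
        by (rule sum.cong[OF refl], rule slice) simp
      also have "\<dots> \<le> card I"
        using finE by (simp add: I_def card_cartesian_product card_mono)
      finally show ?thesis .
    qed
    finally have "card {x\<in>I. s k x \<notin> I} * n \<le> 2 * card I" by simp
    then have "real (card {x\<in>I. s k x \<notin> I} * n) \<le> real (2 * card I)"
      by (simp only: of_nat_le_iff)
    then show ?thesis using n0 by (simp add: field_simps)
  qed
  have inj_I: "inj_on (s k) I" for k
    using inj by (rule inj_on_subset) simp
  obtain Y where Y: "Y \<subseteq> \<phi> ` I" "Y \<noteq> {}"
    "\<And>k. k \<in> K \<Longrightarrow> real (card {y\<in>Y. fst k * y + snd k \<notin> Y})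
      \<le> real (card K) * (2 / real n) * real (card Y)"
    by (rule almost_invariant_superlevel_set[OF finI I_ne, of K s \<phi> "\<lambda>k y. fst k * y + snd k"])
      (use inj_I eqv bd K in blast)+
  show thesis
  proof (rule that[of Y])
    show "finite Y" using Y(1) finI finite_surj by blast
    show "Y \<noteq> {}" by (rule Y)
    show "Y \<inter> Z = {}"
    proof -
      have "\<phi> x \<notin> Z" if x: "x \<in> I" for x
      proof
        assume z: "\<phi> x \<in> Z"
        obtain e c where xe: "x = (e, c)" by (cases x)
        have "t = \<phi> x / w e - p c" using w_nz[of e] by (simp add: \<phi>_def xe)
        then have "t \<in> U" unfolding U_def using x z xe by force
        with t show False ..
      qed
      with Y(1) show ?thesis by blast
    qed
    fix k assume k: "k \<in> K"
    have "real (card K) * (2 / real n) \<le> \<epsilon>"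
      using n n0 eps by (simp add: field_simps)
    then have "real (card K) * (2 / real n) * real (card Y) \<le> \<epsilon> * real (card Y)"
      by (rule mult_right_mono) simp
    with Y(3)[OF k] show "real (card {y\<in>Y. fst k * y + snd k \<notin> Y}) \<le> \<epsilon> * real (card Y)"
      by linarith
  qed
qed

section \<open>Large sets, and the translation to lines\<close>

text \<open>A point of either set that leaves the union also leaves its own set, so for disjoint
  sets both sides of the estimate add up. Each nonempty set taken off the previous ones adds at
  least one element.\<close>

lemma large_almost_invariant_set:
  fixes K :: "('a::field \<times> 'a) set" and \<epsilon> :: real
  assumes "infinite (UNIV :: 'a set)" "finite K"
    and "\<And>k. k \<in> K \<Longrightarrow> fst k \<noteq> 0" and "\<epsilon> > 0"
  shows "\<exists>Y. finite Y \<and> m \<le> card Y \<and>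
    (\<forall>k\<in>K. real (card {y\<in>Y. fst k * y + snd k \<notin> Y}) \<le> \<epsilon> * real (card Y))"
proof (induction m)
  case 0
  show ?case by (rule exI[of _ "{}"]) simp
next
  case (Suc m)
  then obtain Z where Z: "finite Z" "m \<le> card Z"
    "\<And>k. k \<in> K \<Longrightarrow> real (card {y\<in>Z. fst k * y + snd k \<notin> Z}) \<le> \<epsilon> * real (card Z)"
    by blast
  obtain Y where Y: "finite Y" "Y \<noteq> {}" "Y \<inter> Z = {}"
    "\<And>k. k \<in> K \<Longrightarrow> real (card {y\<in>Y. fst k * y + snd k \<notin> Y}) \<le> \<epsilon> * real (card Y)"
    using almost_invariant_set_avoiding[OF assms Z(1)] by blast
  have card: "card (Y \<union> Z) = card Y + card Z"
    using Y Z by (simp add: card_Un_disjoint)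
  have "0 < card Y" using Y by (simp add: card_gt_0_iff)
  moreover have "real (card {y\<in>Y \<union> Z. fst k * y + snd k \<notin> Y \<union> Z}) \<le> \<epsilon> * real (card (Y \<union> Z))"
    if k: "k \<in> K" for k
  proof -
    have "card {y\<in>Y \<union> Z. fst k * y + snd k \<notin> Y \<union> Z}
        \<le> card ({y\<in>Y. fst k * y + snd k \<notin> Y} \<union> {y\<in>Z. fst k * y + snd k \<notin> Z})"
      using Y(1) Z(1) by (intro card_mono) auto
    also have "\<dots> \<le> card {y\<in>Y. fst k * y + snd k \<notin> Y} + card {y\<in>Z. fst k * y + snd k \<notin> Z}"
      by (rule card_Un_le)
    finally show ?thesis
      using Y(4)[OF k] Z(3)[OF k] unfolding card by (simp add: distrib_left)
  qed
  ultimately show ?case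
    using Y(1) Z(1,2) card by (intro exI[of _ "Y \<union> Z"]) auto
qed

theorem theorem2p1:
  fixes L :: "('a::field \<times> 'a) set set" and \<epsilon> N :: real
  assumes "infinite (UNIV :: 'a set)"
    and "finite L"
    and "\<forall>l\<in>L. \<exists>a b. a \<noteq> 0 \<and> l = graph_line a b"
    and "\<epsilon> > 0" and "N > 0"
  shows "\<exists>Y :: 'a set. finite Y \<and> real (card Y) \<ge> N \<and>
           (\<forall>l\<in>L. real (card ((Y \<times> Y) \<inter> l)) \<ge> (1 - \<epsilon>) * real (card Y))"
proof -
  have "\<forall>l\<in>L. \<exists>k. fst k \<noteq> 0 \<and> l = graph_line (fst k) (snd k)"
    using assms(3) by fastforce
  then obtain h where h: "\<And>l. l \<in> L \<Longrightarrow> fst (h l) \<noteq> 0 \<and> l = graph_line (fst (h l)) (snd (h l))"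
    by metis
  obtain m :: nat where m: "N \<le> real m" using real_arch_simple by blast
  have "\<exists>Y. finite Y \<and> m \<le> card Y \<and>
      (\<forall>k\<in>h ` L. real (card {y\<in>Y. fst k * y + snd k \<notin> Y}) \<le> \<epsilon> * real (card Y))"
    by (rule large_almost_invariant_set) (use assms h in auto)
  then obtain Y where Y: "finite Y" "m \<le> card Y"
    "\<And>l. l \<in> L \<Longrightarrow> real (card {y\<in>Y. fst (h l) * y + snd (h l) \<notin> Y}) \<le> \<epsilon> * real (card Y)"
    by blast
  have "(1 - \<epsilon>) * real (card Y) \<le> real (card ((Y \<times> Y) \<inter> l))" if l: "l \<in> L" for l
  proof -
    define g where "g y = fst (h l) * y + snd (h l)" for y
    have "l = {(x, y). y = g x}"
      using h[OF l] by (simp add: graph_line_def g_def)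
    \<comment> \<open>The incidences on a line are parametrised by their first coordinate, so those
      missing from \<open>card Y\<close> are exactly the points that the affine map moves out of
      \<open>Y\<close>.\<close>
    then have "(Y \<times> Y) \<inter> l = (\<lambda>y. (y, g y)) ` {y\<in>Y. g y \<in> Y}"
      by auto
    then have "card ((Y \<times> Y) \<inter> l) = card {y\<in>Y. g y \<in> Y}"
      by (simp add: card_image inj_on_def)
    moreover have "card Y = card {y\<in>Y. g y \<in> Y} + card {y\<in>Y. g y \<notin> Y}"
      using Y(1) by (subst card_Un_disjoint[symmetric]) (auto intro!: arg_cong[where f = card])
    ultimately show ?thesis
      using Y(3)[OF l] by (simp add: g_def left_diff_distrib)
  qed
  moreover have "N \<le> real (card Y)" using m Y(2) by linarith
  ultimately show ?thesis using Y(1) by blast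
qed

end
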